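(* Let $\alpha\in\mathbb Z\setminus\{0,1\}$ and let $(h_n)$ be the sequence with $h_0=0$, $h_1=1$, $h_2=-\alpha^3(\alpha-1)(2\alpha-1)$, $h_3=-\alpha^8(\alpha-1)^3(2\alpha-1)^3$, $h_4=\alpha^{14}(\alpha-1)^6(2\alpha-1)^6$, and for $m\ge2$: $h_{2m+1}=h_{m+2}h_m^3-h_{m-1}h_{m+1}^3$, for $m\ge 3$: $h_{2m}=h_m\big(h_{m+2}h_{m-1}^2-h_{m-2}h_{m+1}^2\big)/h_2$. (i) If $n\equiv 1,4,12,15\pmod{16}$, then $h_n$ is a square. (ii) If $n\equiv 3,13\pmod{16}$, then $h_n$ is a square if and only if $(\alpha-1)(2\alpha-1)$ is a square. (iii) If $n\equiv 5,11\pmod{16}$, then $h_n$ is a square if and only if $\alpha(2\alpha-1)$ is a square.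
   Context: The sequence defined is the elliptic divisibility sequence attached to the point $(0,0)$ of order $8$ on the curve $y^2+(\alpha-\xi)xy-\alpha^3\xi y=x^3-\alpha^2\xi x^2$ with $\xi=(2\alpha-1)(\alpha-1)$ (an integral model of the Tate normal form); its eighth term is zero. Convention: an integer $m$ is called a square if $m=\pm\beta^2$ for some nonzero integer $\beta$, and a cube if $m=\beta^3$ for some nonzero integer $\beta$. *)

theory Defs
  imports Complex_Main
begin

text \<open>
  An integer is called a square if it is plus or minus the square of a nonzero integer; in
  particular 0 is not a square. The definition is polymorphic so that it also applies to a
  rational number, for which it includes being an integer.
\<close>

definition is_pm_square :: "'a::ring_1 \<Rightarrow> bool" where
  "is_pm_square x \<longleftrightarrow>
     (\<exists>\<beta>::int. \<beta> \<noteq> 0 \<and> (x = of_int (\<beta>\<^sup>2) \<or> x = of_int (- (\<beta>\<^sup>2))))"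

text \<open>
  The terms are taken in the rationals so that the division by \<open>h 2\<close> is true division and
  integrality is not presupposed. The conditions determine \<open>h\<close> uniquely from \<open>\<alpha>\<close>.
\<close>

definition eds_order8 :: "int \<Rightarrow> (nat \<Rightarrow> rat) \<Rightarrow> bool" where
  "eds_order8 \<alpha> h \<longleftrightarrow>
     h 0 = 0 \<and>
     h 1 = 1 \<and>
     h 2 = of_int (- (\<alpha> ^ 3 * (\<alpha> - 1) * (2 * \<alpha> - 1))) \<and>
     h 3 = of_int (- (\<alpha> ^ 8 * (\<alpha> - 1) ^ 3 * (2 * \<alpha> - 1) ^ 3)) \<and>
     h 4 = of_int (\<alpha> ^ 14 * (\<alpha> - 1) ^ 6 * (2 * \<alpha> - 1) ^ 6) \<and>
     (\<forall>m\<ge>2. h (2 * m + 1) = h (m + 2) * h m ^ 3 - h (m - 1) * h (m + 1) ^ 3) \<and>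
     (\<forall>m\<ge>3. h (2 * m) =
        h m * (h (m + 2) * h (m - 1) ^ 2 - h (m - 2) * h (m + 1) ^ 2) / h 2)"

end

theory Submission
  imports Defs
begin

text \<open>
  Write \<open>a = \<alpha>\<close>, \<open>b = \<alpha> - 1\<close>, \<open>c = 2\<alpha> - 1\<close>. Since the point has order 8, the sequence is
  quasi-periodic: \<open>h (n + 8) = - D ^ (n + 4) * h n\<close> with \<open>D = - a ^ 15 * b ^ 7 * c ^ 6\<close>.
  Both recurrences are homogeneous with respect to this shift, so they need to be checked only for
  eight consecutive indices, where they reduce to \<open>a - 1 = b\<close>, \<open>c - a = b\<close> and
  \<open>a ^ 2 - c = b ^ 2\<close>. Shifting twice multiplies a term by the nonzero square \<open>D ^ (2 * n + 16)\<close>,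
  so whether \<open>h n\<close> is a square depends only on \<open>n mod 16\<close>, and the first sixteen terms are
  explicit monomials in \<open>a\<close>, \<open>b\<close>, \<open>c\<close>.
\<close>

text \<open>The table holds one period, and the last branch builds the shift by 8 into the
  definition, with \<open>n - 4\<close> being \<open>(n - 8) + 4\<close>. The shift therefore holds
  for independent \<open>a\<close>, \<open>b\<close>, \<open>c\<close>; relations between them enter
  only when the recurrences are checked.\<close>

fun eds_monomial :: "int \<Rightarrow> int \<Rightarrow> int \<Rightarrow> nat \<Rightarrow> int" where
  "eds_monomial a b c n =
     (if n < 8 then
        [0, 1, - (a ^ 3 * b * c), - (a ^ 8 * b ^ 3 * c ^ 3), a ^ 14 * b ^ 6 * c ^ 6,
         a ^ 23 * b ^ 10 * c ^ 9, - (a ^ 33 * b ^ 15 * c ^ 13), - (a ^ 45 * b ^ 21 * c ^ 18)] ! n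
      else - ((- (a ^ 15 * b ^ 7 * c ^ 6)) ^ (n - 4)) * eds_monomial a b c (n - 8))"

declare eds_monomial.simps [simp del]

lemma eds_monomial_add_8:
  "eds_monomial a b c (n + 8) = - ((- (a ^ 15 * b ^ 7 * c ^ 6)) ^ (n + 4)) * eds_monomial a b c n"
  by (subst eds_monomial.simps) (simp add: add.commute)

text \<open>In two successive shifts the signs cancel and the exponents \<open>n + 12\<close> and
  \<open>n + 4\<close> add up to an even number. This is why squareness has period 16, although the
  zeros have period 8.\<close>

lemma eds_monomial_add_16:
  "eds_monomial a b c (n + 16) =
     (- (a ^ 15 * b ^ 7 * c ^ 6)) ^ (2 * n + 16) * eds_monomial a b c n"
proof -
  define D where "D = - (a ^ 15 * b ^ 7 * c ^ 6)"
  have "eds_monomial a b c (n + 16) = eds_monomial a b c (n + 8 + 8)"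
    by (simp add: add.commute)
  also have "\<dots> = D ^ (2 * n + 16) * eds_monomial a b c n"
    unfolding eds_monomial_add_8 D_def[symmetric] by (simp add: algebra_simps flip: power_add)
  finally show ?thesis
    by (simp only: D_def)
qed

text \<open>The list stops at 20 because the base cases \<open>m\<close> = 0, ..., 7 of the two
  recurrences reach \<open>2 * m + 5\<close> = 19 and \<open>2 * m + 6\<close> = 20. Index 1 appears
  as \<open>Suc 0\<close> to match the simplifier's normal form.\<close>

lemma eds_monomial_values:
  "eds_monomial a b c 0 = 0"
  "eds_monomial a b c (Suc 0) = 1"
  "eds_monomial a b c 2 = - (a ^ 3 * b * c)"
  "eds_monomial a b c 3 = - (a ^ 8 * b ^ 3 * c ^ 3)"
  "eds_monomial a b c 4 = a ^ 14 * b ^ 6 * c ^ 6"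
  "eds_monomial a b c 5 = a ^ 23 * b ^ 10 * c ^ 9"
  "eds_monomial a b c 6 = - (a ^ 33 * b ^ 15 * c ^ 13)"
  "eds_monomial a b c 7 = - (a ^ 45 * b ^ 21 * c ^ 18)"
  "eds_monomial a b c 8 = 0"
  "eds_monomial a b c 9 = a ^ 75 * b ^ 35 * c ^ 30"
  "eds_monomial a b c 10 = a ^ 93 * b ^ 43 * c ^ 37"
  "eds_monomial a b c 11 = - (a ^ 113 * b ^ 52 * c ^ 45)"
  "eds_monomial a b c 12 = - (a ^ 134 * b ^ 62 * c ^ 54)"
  "eds_monomial a b c 13 = a ^ 158 * b ^ 73 * c ^ 63"
  "eds_monomial a b c 14 = a ^ 183 * b ^ 85 * c ^ 73"
  "eds_monomial a b c 15 = - (a ^ 210 * b ^ 98 * c ^ 84)"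
  "eds_monomial a b c 16 = 0"
  "eds_monomial a b c 17 = a ^ 270 * b ^ 126 * c ^ 108"
  "eds_monomial a b c 18 = - (a ^ 303 * b ^ 141 * c ^ 121)"
  "eds_monomial a b c 19 = - (a ^ 338 * b ^ 157 * c ^ 135)"
  "eds_monomial a b c 20 = a ^ 374 * b ^ 174 * c ^ 150"
  by (simp_all add: eds_monomial.simps, algebra+)

lemma nat_induct_step_8:
  fixes P :: "nat \<Rightarrow> bool"
  assumes "P 0" "P 1" "P 2" "P 3" "P 4" "P 5" "P 6" "P 7"
    and step: "\<And>m. P m \<Longrightarrow> P (m + 8)"
  shows "P m"
proof (induction m rule: less_induct)
  case (less m)
  show ?case
  proof (cases "m < 8")
    case True
    then have "m \<in> {0, 1, 2, 3, 4, 5, 6, 7}"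
      by auto
    then show ?thesis
      using assms(1-8) by blast
  next
    case False
    then show ?thesis
      using step[of "m - 8"] less[of "m - 8"] by simp
  qed
qed

text \<open>The recurrence is indexed from its first valid instance, so no truncated subtraction of
  naturals occurs.\<close>

lemma eds_monomial_odd:
  fixes a b c :: int
  assumes ab: "a - 1 = b" and ac: "a\<^sup>2 - c = b\<^sup>2"
  defines "H \<equiv> eds_monomial a b c"
  shows "H (2 * m + 5) = H (m + 4) * H (m + 2) ^ 3 - H (m + 1) * H (m + 3) ^ 3"
proof (induction m rule: nat_induct_step_8)
  \<comment> \<open>For \<open>m\<close> = 0 the right-hand side is a ^ 23 * b ^ 9 * c ^ 9 times a -
    1. In the next three cases too, the multiplier is, up to sign, the common monomial factor of the
    two products, and what remains is one of the assumed relations.\<close>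
  case 1
  show ?case
    using arg_cong[OF ab, of "(*) (a ^ 23 * b ^ 9 * c ^ 9)"]
    by (simp add: H_def eds_monomial_values flip: numeral_2_eq_2) algebra
next
  case 2
  show ?case
    using arg_cong[OF ac, of "(*) (a ^ 45 * b ^ 19 * c ^ 18)"]
    by (simp add: H_def eds_monomial_values flip: numeral_2_eq_2) algebra
next
  case 3
  show ?case
    using arg_cong[OF ac, of "(*) (a ^ 75 * b ^ 33 * c ^ 30)"]
    by (simp add: H_def eds_monomial_values flip: numeral_2_eq_2) algebra
next
  case 4
  show ?case
    using arg_cong[OF ab, of "(*) (a ^ 113 * b ^ 51 * c ^ 45)"]
    by (simp add: H_def eds_monomial_values flip: numeral_2_eq_2) algebra
next
  case (9 m)
  define D where "D = - (a ^ 15 * b ^ 7 * c ^ 6)"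
  have shift: "H (n + 8) = - (D ^ (n + 4)) * H n" "H (n + 16) = D ^ (2 * n + 16) * H n" for n
    unfolding H_def D_def by (rule eds_monomial_add_8 eds_monomial_add_16)+
  \<comment> \<open>Both products on the right scale by the same power: (m + 8) + 3 * (m + 6) = (m +
    5) + 3 * (m + 7) = 4 * m + 26. The four minus signs in each product cancel.\<close>
  have "H (2 * (m + 8) + 5) = D ^ (4 * m + 26) * H (2 * m + 5)"
    using shift(2)[of "2 * m + 5"] by (simp add: algebra_simps)
  also have "\<dots> = H (m + 4 + 8) * H (m + 2 + 8) ^ 3 - H (m + 1 + 8) * H (m + 3 + 8) ^ 3"
    unfolding 9 shift(1)
    by (simp add: algebra_simps power_mult_distrib flip: power_mult power_add)
  finally show ?case
    by (simp add: add_ac)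
\<comment> \<open>For \<open>m\<close> = 4, ..., 7 one of the two products contains
  \<open>H 8\<close>, which is 0, so only an identity of monomials is left.\<close>
qed (simp_all add: H_def eds_monomial_values power_mult_distrib flip: power_mult power_add, algebra+)

text \<open>Multiplying through by \<open>H 2\<close> keeps the identity in the integers. The
  relation c - a = b is used only for \<open>m\<close> = 0 and \<open>m\<close> = 2; for
  \<open>m\<close> = 1 the two products cancel identically, and from \<open>m\<close> = 3 on a
  factor \<open>H 8\<close> kills at least one of them.\<close>

lemma eds_monomial_even:
  fixes a b c :: int
  assumes cab: "c - a = b"
  defines "H \<equiv> eds_monomial a b c"
  shows "H 2 * H (2 * m + 6) =
    H (m + 3) * (H (m + 5) * H (m + 2) ^ 2 - H (m + 1) * H (m + 4) ^ 2)"
proof (induction m rule: nat_induct_step_8)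
  case 1
  show ?case
    using arg_cong[OF cab, of "(*) (a ^ 36 * b ^ 15 * c ^ 14)"]
    by (simp add: H_def eds_monomial_values flip: numeral_2_eq_2) algebra
next
  case 3
  show ?case
    using arg_cong[OF cab, of "(*) (a ^ 96 * b ^ 43 * c ^ 38)"]
    by (simp add: H_def eds_monomial_values flip: numeral_2_eq_2) algebra
next
  case (9 m)
  define D where "D = - (a ^ 15 * b ^ 7 * c ^ 6)"
  have shift: "H (n + 8) = - (D ^ (n + 4)) * H n" "H (n + 16) = D ^ (2 * n + 16) * H n" for n
    unfolding H_def D_def by (rule eds_monomial_add_8 eds_monomial_add_16)+
  have "H 2 * H (2 * (m + 8) + 6) = D ^ (4 * m + 28) * (H 2 * H (2 * m + 6))"
    using shift(2)[of "2 * m + 6"] by (simp add: algebra_simps)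
  also have "\<dots> = H (m + 3 + 8) *
      (H (m + 5 + 8) * H (m + 2 + 8) ^ 2 - H (m + 1 + 8) * H (m + 4 + 8) ^ 2)"
    unfolding 9 shift(1)
    by (simp add: algebra_simps power_mult_distrib flip: power_mult power_add)
  finally show ?case
    by (simp add: add_ac)
qed (simp_all add: H_def eds_monomial_values flip: numeral_2_eq_2, algebra+)

lemma eds_order8_eq_monomial:
  assumes "\<alpha> \<noteq> 0" and "\<alpha> \<noteq> 1" and eds: "eds_order8 \<alpha> h"
  shows "h n = of_int (eds_monomial \<alpha> (\<alpha> - 1) (2 * \<alpha> - 1) n)"
proof (induction n rule: less_induct)
  case (less n)
  let ?H = "eds_monomial \<alpha> (\<alpha> - 1) (2 * \<alpha> - 1)"
  have H2: "?H 2 \<noteq> 0"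
  proof -
    \<comment> \<open>An odd integer is nonzero.\<close>
    have "2 * \<alpha> - 1 \<noteq> 0"
      by presburger
    then show ?thesis
      using assms(1,2) by (simp add: eds_monomial_values)
  qed
  have h2: "h 2 = of_int (?H 2)"
    using eds by (simp add: eds_order8_def eds_monomial_values)
  consider "n < 5" | m where "n = 2 * m + 5" | m where "n = 2 * m + 6"
  proof -
    have "n < 5 \<or> n = 2 * ((n - 5) div 2) + 5 \<or> n = 2 * ((n - 6) div 2) + 6"
      by presburger
    then show ?thesis
      using that by blast
  qed
  then show ?case
  proof cases
    case 1
    then have "n \<in> {0, 1, 2, 3, 4}"
      by auto
    then show ?thesis
      using eds by (auto simp: eds_order8_def eds_monomial_values)
  next
    case (2 m)
    have rec: "h (2 * k + 1) = h (k + 2) * h k ^ 3 - h (k - 1) * h (k + 1) ^ 3" if "k \<ge> 2" for k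
      using eds that unfolding eds_order8_def by blast
    have "h n = h (m + 4) * h (m + 2) ^ 3 - h (m + 1) * h (m + 3) ^ 3"
      using rec[of "m + 2"] by (simp add: 2 eval_nat_numeral)
    also have "\<dots> = of_int (?H (m + 4) * ?H (m + 2) ^ 3 - ?H (m + 1) * ?H (m + 3) ^ 3)"
      using less by (simp add: 2)
    also have "\<dots> = of_int (?H n)"
      unfolding 2
      by (subst eds_monomial_odd) (auto simp: power2_eq_square algebra_simps)
    finally show ?thesis .
  next
    case (3 m)
    have rec: "h (2 * k) = h k * (h (k + 2) * h (k - 1) ^ 2 - h (k - 2) * h (k + 1) ^ 2) / h 2"
      if "k \<ge> 3" for k
      using eds that unfolding eds_order8_def by blast
    have "h n = h (m + 3) * (h (m + 5) * h (m + 2) ^ 2 - h (m + 1) * h (m + 4) ^ 2) / h 2"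
      using rec[of "m + 3"] by (simp add: 3 eval_nat_numeral)
    also have "\<dots> = of_int (?H (m + 3) *
        (?H (m + 5) * ?H (m + 2) ^ 2 - ?H (m + 1) * ?H (m + 4) ^ 2)) / of_int (?H 2)"
      using less by (simp add: 3 h2)
    also have "\<dots> = of_int (?H 2 * ?H n) / of_int (?H 2)"
      unfolding 3 by (subst eds_monomial_even) auto
    also have "\<dots> = of_int (?H n)"
      using H2 by simp
    finally show ?thesis .
  qed
qed

lemma is_pm_square_of_int_rat: "is_pm_square (of_int x :: rat) \<longleftrightarrow> is_pm_square x"
  unfolding is_pm_square_def of_int_eq_iff by simp

lemma is_pm_square_minus: "is_pm_square (- x) \<longleftrightarrow> is_pm_square (x :: int)"
  unfolding is_pm_square_def by (auto simp: minus_equation_iff[of x] equation_minus_iff)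

lemma is_pm_square_power2: "d \<noteq> 0 \<Longrightarrow> is_pm_square (d\<^sup>2 :: int)"
  unfolding is_pm_square_def by auto

text \<open>The substantial direction is cancellation: if d ^ 2 divides \<beta> ^ 2 then d divides
  \<beta>, and the quotient is the new root, nonzero because \<beta> is.\<close>

lemma is_pm_square_power2_mult:
  fixes d x :: int
  assumes "d \<noteq> 0"
  shows "is_pm_square (d\<^sup>2 * x) \<longleftrightarrow> is_pm_square x"
proof
  assume "is_pm_square (d\<^sup>2 * x)"
  then obtain \<beta> where \<beta>: "\<beta> \<noteq> 0" "d\<^sup>2 * x = \<beta>\<^sup>2 \<or> d\<^sup>2 * x = - (\<beta>\<^sup>2)"
    unfolding is_pm_square_def by auto
  then have "d\<^sup>2 dvd \<beta>\<^sup>2"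
    by (metis dvd_minus_iff dvd_triv_left)
  then obtain \<gamma> where \<gamma>: "\<beta> = d * \<gamma>"
    by auto
  then have "d\<^sup>2 * x = d\<^sup>2 * \<gamma>\<^sup>2 \<or> d\<^sup>2 * x = d\<^sup>2 * (- (\<gamma>\<^sup>2))"
    using \<beta>(2) by (simp add: power_mult_distrib)
  then have "x = \<gamma>\<^sup>2 \<or> x = - (\<gamma>\<^sup>2)"
    using assms by (metis mult_left_cancel zero_eq_power2)
  then show "is_pm_square x"
    unfolding is_pm_square_def using \<beta>(1) \<gamma> by auto
next
  assume "is_pm_square x"
  then obtain \<beta> where "\<beta> \<noteq> 0" "x = \<beta>\<^sup>2 \<or> x = - (\<beta>\<^sup>2)"
    unfolding is_pm_square_def by auto
  then have "d * \<beta> \<noteq> 0" "d\<^sup>2 * x = (d * \<beta>)\<^sup>2 \<or> d\<^sup>2 * x = - ((d * \<beta>)\<^sup>2)"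
    using assms by (auto simp: power_mult_distrib)
  then show "is_pm_square (d\<^sup>2 * x)"
    unfolding is_pm_square_def by (metis of_int_eq_id id_apply)
qed

lemma is_pm_square_eds_monomial_mod_16:
  assumes "a \<noteq> 0" "b \<noteq> 0" "c \<noteq> 0"
  shows "is_pm_square (eds_monomial a b c n) \<longleftrightarrow> is_pm_square (eds_monomial a b c (n mod 16))"
proof (induction n rule: less_induct)
  case (less n)
  show ?case
  proof (cases "n < 16")
    case False
    then obtain k where k: "n = k + 16"
      by (metis add.commute le_Suc_ex not_less)
    \<comment> \<open>Half of the even exponent \<open>2 * k + 16\<close> gives the root of the
      shift factor.\<close>
    let ?d = "(- (a ^ 15 * b ^ 7 * c ^ 6)) ^ (k + 8)"
    have "eds_monomial a b c n = ?d\<^sup>2 * eds_monomial a b c k"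
      unfolding k eds_monomial_add_16 by (simp add: algebra_simps flip: power_mult)
    moreover have "?d \<noteq> 0"
      using assms by simp
    ultimately show ?thesis
      using less[of k] is_pm_square_power2_mult[of ?d] by (simp add: k)
  qed simp
qed

theorem theorem5p11:
  fixes \<alpha> :: int and h :: "nat \<Rightarrow> rat"
  assumes "\<alpha> \<noteq> 0" and "\<alpha> \<noteq> 1"
    and "eds_order8 \<alpha> h"
  shows "(\<forall>n. n mod 16 \<in> {1, 4, 12, 15} \<longrightarrow> is_pm_square (h n)) \<and>
         (\<forall>n. n mod 16 \<in> {3, 13} \<longrightarrow>
            (is_pm_square (h n) \<longleftrightarrow> is_pm_square ((\<alpha> - 1) * (2 * \<alpha> - 1)))) \<and>
         (\<forall>n. n mod 16 \<in> {5, 11} \<longrightarrow>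
            (is_pm_square (h n) \<longleftrightarrow> is_pm_square (\<alpha> * (2 * \<alpha> - 1))))"
proof -
  define b c where "b = \<alpha> - 1" and "c = 2 * \<alpha> - 1"
  let ?H = "eds_monomial \<alpha> b c"
  have nz: "\<alpha> \<noteq> 0" "b \<noteq> 0" "c \<noteq> 0"
    using assms(1,2) unfolding b_def c_def by presburger+
  have sq: "is_pm_square (h n) \<longleftrightarrow> is_pm_square (?H (n mod 16))" for n
    using eds_order8_eq_monomial[OF assms, of n] is_pm_square_eds_monomial_mod_16[OF nz, of n]
    by (simp add: is_pm_square_of_int_rat b_def c_def)
  have square: "is_pm_square x" if "x = d\<^sup>2 \<or> x = - (d\<^sup>2)" "d \<noteq> 0" for x d :: int
    using that is_pm_square_power2[of d] by (auto simp: is_pm_square_minus)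
  have square_iff: "is_pm_square x \<longleftrightarrow> is_pm_square y"
    if "x = d\<^sup>2 * y \<or> x = - (d\<^sup>2 * y)" "d \<noteq> 0" for x y d :: int
    using that is_pm_square_power2_mult[of d y] by (auto simp: is_pm_square_minus)
  \<comment> \<open>In each case below the witness takes half of every exponent, rounded down. The
    odd exponents leave one factor each, giving b * c for 3 and 13 and \<alpha> * c for 5 and 11;
    signs do not matter.\<close>
  have "is_pm_square (?H 1)"
    by (rule square[of _ 1]) (simp_all add: eds_monomial_values)
  moreover have "is_pm_square (?H 4)"
    by (rule square[of _ "\<alpha> ^ 7 * b ^ 3 * c ^ 3"])
      (simp_all add: eds_monomial_values nz power_mult_distrib flip: power_mult)
  moreover have "is_pm_square (?H 12)"
    by (rule square[of _ "\<alpha> ^ 67 * b ^ 31 * c ^ 27"])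
      (simp_all add: eds_monomial_values nz power_mult_distrib flip: power_mult)
  moreover have "is_pm_square (?H 15)"
    by (rule square[of _ "\<alpha> ^ 105 * b ^ 49 * c ^ 42"])
      (simp_all add: eds_monomial_values nz power_mult_distrib flip: power_mult)
  moreover have "is_pm_square (?H 3) \<longleftrightarrow> is_pm_square (b * c)"
    by (rule square_iff[of _ "\<alpha> ^ 4 * b * c"]) (simp add: eds_monomial_values, algebra, simp add: nz)
  moreover have "is_pm_square (?H 13) \<longleftrightarrow> is_pm_square (b * c)"
    by (rule square_iff[of _ "\<alpha> ^ 79 * b ^ 36 * c ^ 31"])
      (simp add: eds_monomial_values, algebra, simp add: nz)
  moreover have "is_pm_square (?H 5) \<longleftrightarrow> is_pm_square (\<alpha> * c)"
    by (rule square_iff[of _ "\<alpha> ^ 11 * b ^ 5 * c ^ 4"])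
      (simp add: eds_monomial_values, algebra, simp add: nz)
  moreover have "is_pm_square (?H 11) \<longleftrightarrow> is_pm_square (\<alpha> * c)"
    by (rule square_iff[of _ "\<alpha> ^ 56 * b ^ 26 * c ^ 22"])
      (simp add: eds_monomial_values, algebra, simp add: nz)
  ultimately show ?thesis
    unfolding sq by (auto simp flip: b_def c_def)
qed

end
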